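(* Let $\{(A_n,p_n)\}_{n\in\mathbb{N}}$ be a rare-events source with support interval $C=[\check c,\hat c]$ and limit distribution $P$. Consider a canonical estimation problem with limit function $f$. Suppose $D>1$ is a (known) constant with $[D^{-1},D]\supseteq C$. Let $\tilde P_n$, $n\in\mathbb{N}$, be random probability measures on $\mathbb{R}^+$, where $\tilde P_n$ is constructed from the samples $X_{n,1},\dots,X_{n,n}$, such that almost surely $\tilde P_n\Rightarrow P$ weakly as $n\to\infty$. Then $$\hat Y_n=\int_{\mathbb{R}^+} f_D(x)\,\mathrm{d}\tilde P_n(x)$$ is a consistent estimator, i.e. $\hat Y_n\to\int_C f(x)\,\mathrm{d}P(x)$ almost surely as $n\to\infty$. Furthermore, if $f$ is bounded everywhere, one can choose $D=\infty$ with no knowledge of $C$: that is, $\hat Y_n=\int_{\mathbb{R}^+} f(x)\,\mathrm{d}\tilde P_n(x)$ is then a consistent estimator.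
   Context: Rare-events source: a sequence $\{(A_n,p_n)\}_{n\in\mathbb{N}}$, where $A_n$ is a finite alphabet and $p_n$ a probability mass function on $A_n$, such that, with $X_n\sim p_n$, $Z_n=n\,p_n(X_n)$ and $P_n$ the distribution of $Z_n$: (i) there is an interval $C=[\check c,\hat c]$ with $0<\check c\le\hat c<\infty$ such that $\check c/n\le p_n(a)\le\hat c/n$ for all $n$ and all $a\in A_n$; (ii) there is a probability distribution $P$ with $P_n\Rightarrow P$ weakly (so $P$ is supported on $C$). Sampling: for each $n$, $X_{n,1},\dots,X_{n,n}$ are i.i.d. from $p_n$; all samples live on a common probability space. Canonical estimation problem: the problem of estimating, from $X_{n,1},\dots,X_{n,n}$ for each $n$, a sequence of real random variables $\{Y_n\}$ such that for every rare-events source $\mathbf{E}[Y_n]=\int_C f_n(x)\,\mathrm{d}P_n(x)$, where $\{f_n\}$ is a sequence of continuous real-valued functions on $(0,\infty)$ converging pointwise to a continuous function $f$ on $(0,\infty)$; $f$ is called the limit function of the problem. An estimator is a sequence $\hat Y_n$ of real-valued functions of the samples $X_{n,1},\dots,X_{n,n}$; it is consistent if $\hat Y_n\to\int_C f\,\mathrm{d}P$ almost surely. Tapered function: for a real-valued function $g$ on $(0,\infty)$ and $D\ge1$, $g_D$ is defined on $\mathbb{R}^+=[0,\infty)$ by $g_D(x)=g(D^{-1})$ for $x<D^{-1}$, $g_D(x)=g(x)$ for $x\in[D^{-1},D]$, and $g_D(x)=g(D)$ for $x>D$. In the case $D=\infty$, $f$ is given an arbitrary fixed real value at $0$. *)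

theory Defs
  imports "HOL-Probability.Probability"
begin

(* The alphabets are finite subsets of one ambient type. Index 0 carries no information:
   every condition on the n-th alphabet, law or sample is imposed for n >= 1 only. *)

definition scaled_prob_law :: "(nat \<Rightarrow> 'a pmf) \<Rightarrow> nat \<Rightarrow> real measure" where
  "scaled_prob_law p n = distr (measure_pmf (p n)) borel (\<lambda>a. real n * pmf (p n) a)"

locale rare_events_source =
  fixes A :: "nat \<Rightarrow> 'a set"
    and p :: "nat \<Rightarrow> 'a pmf"
    and cl ch :: real
    and P :: "real measure"
  assumes finite_alphabet: "\<And>n. n \<ge> 1 \<Longrightarrow> finite (A n)"
    and pmf_on_alphabet: "\<And>n. n \<ge> 1 \<Longrightarrow> set_pmf (p n) \<subseteq> A n"
    and cl_pos: "0 < cl"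
    and cl_le_ch: "cl \<le> ch"
    and pmf_bounds: "\<And>n a. n \<ge> 1 \<Longrightarrow> a \<in> A n \<Longrightarrow>
          cl / real n \<le> pmf (p n) a \<and> pmf (p n) a \<le> ch / real n"
    and limit_distribution: "real_distribution P"
    and weak_limit: "weak_conv_m (scaled_prob_law p) P"

(* No relation is imposed between the samples for different n. *)
locale sampled_source = rare_events_source A p cl ch P + prob_space M
  for A :: "nat \<Rightarrow> 'a set" and p :: "nat \<Rightarrow> 'a pmf" and cl ch :: real
    and P :: "real measure" and M :: "'w measure" +
  fixes X :: "nat \<Rightarrow> nat \<Rightarrow> 'w \<Rightarrow> 'a"
  assumes sample_indep: "\<And>n. n \<ge> 1 \<Longrightarrow> indep_vars (\<lambda>_. count_space (A n)) (X n) {1..n}"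
    and sample_law: "\<And>n i. n \<ge> 1 \<Longrightarrow> i \<in> {1..n} \<Longrightarrow>
          distr M (count_space UNIV) (X n i) = measure_pmf (p n)"

definition sample :: "(nat \<Rightarrow> nat \<Rightarrow> 'w \<Rightarrow> 'a) \<Rightarrow> nat \<Rightarrow> 'w \<Rightarrow> 'a list" where
  "sample X n \<omega> = map (\<lambda>i. X n i \<omega>) [1..<Suc n]"

(* A problem concerns all sources at once, so the quantity Y to be estimated takes the
   sample space, the source and the samples as arguments. *)
definition canonical_estimation_problem ::
  "('w measure \<Rightarrow> (nat \<Rightarrow> 'a set) \<Rightarrow> (nat \<Rightarrow> 'a pmf) \<Rightarrow> (nat \<Rightarrow> nat \<Rightarrow> 'w \<Rightarrow> 'a) \<Rightarrow> nat \<Rightarrow> 'w \<Rightarrow> real)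
    \<Rightarrow> (nat \<Rightarrow> real \<Rightarrow> real) \<Rightarrow> (real \<Rightarrow> real) \<Rightarrow> bool" where
  "canonical_estimation_problem Y fs f \<longleftrightarrow>
     (\<forall>n\<ge>1. continuous_on {0<..} (fs n)) \<and>
     continuous_on {0<..} f \<and>
     (\<forall>x>0. (\<lambda>n. fs n x) \<longlonglongrightarrow> f x) \<and>
     (\<forall>A p cl ch P M X. sampled_source A p cl ch P M X \<longrightarrow>
        (\<forall>n\<ge>1. integrable M (Y M A p X n) \<and>
           (LINT \<omega>|M. Y M A p X n \<omega>) = (LINT x:{cl..ch}|scaled_prob_law p n. fs n x)))"

(* An estimator maps n and the list of the n samples to a real number. The alphabets being
   finite, no measurability condition is needed. *)
definition consistent_estimator ::
  "'w measure \<Rightarrow> (nat \<Rightarrow> nat \<Rightarrow> 'w \<Rightarrow> 'a) \<Rightarrow> real \<Rightarrow> real \<Rightarrow> real measure \<Rightarrow> (real \<Rightarrow> real)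
    \<Rightarrow> (nat \<Rightarrow> 'a list \<Rightarrow> real) \<Rightarrow> bool" where
  "consistent_estimator M X cl ch P f Yhat \<longleftrightarrow>
     (AE \<omega> in M. (\<lambda>n. Yhat n (sample X n \<omega>)) \<longlonglongrightarrow> (LINT x:{cl..ch}|P. f x))"

definition tapered :: "(real \<Rightarrow> real) \<Rightarrow> real \<Rightarrow> real \<Rightarrow> real" where
  "tapered g D x = (if x < inverse D then g (inverse D) else if x \<le> D then g x else g D)"

(* Probability measures on [0, \<infinity>), encoded as Borel probability measures on the line that give
   the negative half-line mass 0. As [0, \<infinity>) is closed, weak convergence is the same
   in both readings. *)
definition nonneg_distribution :: "real measure \<Rightarrow> bool" where
  "nonneg_distribution Q \<longleftrightarrow> real_distribution Q \<and> measure Q {0..} = 1"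

end

theory Submission
  imports Defs
begin

text \<open>
  The limit law \<open>P\<close> gives full mass to \<open>{cl..ch}\<close>, because the continuous distance to this
  interval has integral \<open>0\<close> under each \<open>P\<^sub>n\<close>. Hence a function which is bounded and continuous
  on \<open>(0, \<infinity>)\<close>, extended by any value at \<open>0\<close>, has only a \<open>P\<close>-null set of discontinuities, and
  the mapping theorem for weak convergence applies. Both estimators are instances: the tapered
  function agrees with \<open>f\<close> on \<open>{cl..ch}\<close> and is bounded and continuous.
\<close>

text \<open>Tapering is composition with the clamping map onto \<open>{inverse D..D}\<close>, so
  continuity and boundedness of \<open>tapered g D\<close> come from \<open>g\<close> on that
  interval alone.\<close>

lemma tapered_eq_clamp:
  assumes "1 \<le> D"
  shows "tapered g D x = g (max (inverse D) (min D x))"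
proof -
  have "inverse D \<le> D"
    using assms inverse_le_1_iff[of D] by linarith
  then show ?thesis
    unfolding tapered_def by (auto simp: max_def min_def)
qed

lemma tapered_eq:
  assumes "x \<in> {inverse D..D}"
  shows "tapered g D x = g x"
  using assms unfolding tapered_def by auto

lemma continuous_on_tapered:
  assumes "1 \<le> D" "continuous_on {0<..} g"
  shows "continuous_on S (tapered g D)"
proof -
  have "continuous_on S (\<lambda>x. g (max (inverse D) (min D x)))"
    by (rule continuous_on_compose2[OF assms(2)])
      (use assms(1) in \<open>auto intro!: continuous_intros simp: less_max_iff_disj\<close>)
  then show ?thesis
    using assms(1) by (simp add: tapered_eq_clamp cong: continuous_on_cong)
qed

lemma bounded_tapered:
  assumes "1 \<le> D" "continuous_on {0<..} g"
  shows "bounded (tapered g D ` S)"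
proof -
  \<comment> \<open>Although \<open>g\<close> may blow up at 0 or at infinity, clamping confines its
    arguments to a compact subset of the open half-line.\<close>
  have "{inverse D..D} \<subseteq> {0<..}"
    using assms(1) by (auto intro: less_le_trans[of 0 "inverse D"])
  then have "compact (g ` {inverse D..D})"
    using assms(2) by (intro compact_continuous_image) (auto intro: continuous_on_subset)
  moreover have "inverse D \<le> D"
    using assms(1) inverse_le_1_iff[of D] by linarith
  then have "tapered g D ` S \<subseteq> g ` {inverse D..D}"
    by (auto simp: tapered_eq_clamp[OF assms(1)])
  ultimately show ?thesis
    using bounded_subset compact_imp_bounded by blast
qed

context rare_events_source
begin

lemma real_distribution_scaled_prob_law: "real_distribution (scaled_prob_law p n)"
  unfolding scaled_prob_law_def by (rule prob_space.real_distribution_distr)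
    (auto simp: prob_space_measure_pmf)

lemma AE_scaled_prob_law_support:
  assumes "n \<ge> 1"
  shows "AE x in scaled_prob_law p n. x \<in> {cl..ch}"
proof -
  have "real n * pmf (p n) a \<in> {cl..ch}" if "a \<in> set_pmf (p n)" for a
    using pmf_bounds[OF assms, of a] pmf_on_alphabet[OF assms] that assms
    by (auto simp: field_simps)
  then show ?thesis
    unfolding scaled_prob_law_def by (subst AE_distr_iff) (auto simp: AE_measure_pmf_iff)
qed

lemma AE_limit_support: "AE x in P. x \<in> {cl..ch}"
proof -
  interpret P: real_distribution P by (rule limit_distribution)
  \<comment> \<open>A continuous substitute for the indicator of the complement of the interval. The
    cut at 1 makes it bounded, so that it is a test function for weak convergence.\<close>
  define g where "g x = min 1 (infdist x {cl..ch})" for x :: real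
  have g_cont: "isCont g x" for x
    unfolding g_def by (intro continuous_intros)
  have g_meas [measurable]: "g \<in> borel_measurable borel"
    using g_cont by (intro borel_measurable_continuous_onI continuous_at_imp_continuous_on) auto
  have g_nonneg: "0 \<le> g x" and g_bound: "norm (g x) \<le> 1" for x
    unfolding g_def by (auto simp: infdist_nonneg)
  have "(\<lambda>n. integral\<^sup>L (scaled_prob_law p n) g) \<longlonglongrightarrow> integral\<^sup>L P g"
    by (rule weak_conv_imp_integral_bdd_continuous_conv[OF real_distribution_scaled_prob_law
          limit_distribution weak_limit g_cont g_bound])
  moreover have "eventually (\<lambda>n. integral\<^sup>L (scaled_prob_law p n) g = 0) sequentially"
    using eventually_ge_at_top[of 1]
  proof eventually_elim
    case (elim n)
    have "AE x in scaled_prob_law p n. g x = 0"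
      using AE_scaled_prob_law_support[OF elim] by eventually_elim (simp add: g_def)
    then show ?case
      by (rule integral_eq_zero_AE)
  qed
  ultimately have "integral\<^sup>L P g = 0"
    by (metis LIMSEQ_unique tendsto_eventually)
  moreover have "integrable P g"
    by (rule P.integrable_const_bound[OF AE_I2[OF g_bound]]) simp
  ultimately have "AE x in P. g x = 0"
    by (subst integral_nonneg_eq_0_iff_AE[symmetric]) (auto intro: g_nonneg)
  then show ?thesis
  proof eventually_elim
    case (elim x)
    then have "infdist x {cl..ch} = 0"
      unfolding g_def by (auto simp: min_def split: if_splits)
    \<comment> \<open>Distance 0 means membership because the interval is closed and, by
      \<open>cl_le_ch\<close>, nonempty.\<close>
    then show ?case
      using in_closed_iff_infdist_zero[of "{cl..ch}" x] cl_le_ch by auto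
  qed
qed

lemma set_integral_weak_conv:
  fixes g :: "real \<Rightarrow> real"
  assumes mu: "\<And>n. n \<ge> 1 \<Longrightarrow> real_distribution (\<mu> n)"
    and conv: "weak_conv_m \<mu> P"
    and g_cont: "continuous_on {0<..} g"
    and g_bdd: "bounded (g ` {0<..})"
  shows "(\<lambda>n. LINT x:{0..}|\<mu> n. g x) \<longlonglongrightarrow> (LINT x:{cl..ch}|P. g x)"
proof -
  interpret P: real_distribution P by (rule limit_distribution)
  \<comment> \<open>The integrand of the set integral over \<open>{0..}\<close>, as a function on
    the whole line. It may jump at 0, where nothing is assumed about \<open>g\<close>.\<close>
  define h where "h x = indicator {0..} x *\<^sub>R g x" for x :: real
  \<comment> \<open>Measurability follows from continuity on the open half-line once the single
    point 0 is split off.\<close>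
  have h_split: "h x = indicator {0<..} x *\<^sub>R g x + indicator {0} x *\<^sub>R g 0" for x
    unfolding h_def by (auto simp: indicator_def)
  have h_meas: "h \<in> borel_measurable borel"
    unfolding h_split[abs_def]
    by (intro borel_measurable_add borel_measurable_continuous_on_indicator g_cont) auto
  obtain B where B: "\<And>x. x > 0 \<Longrightarrow> norm (g x) \<le> B"
    using g_bdd unfolding bounded_iff by auto
  have h_bound: "norm (h x) \<le> max B \<bar>g 0\<bar>" for x
    using B[of x] unfolding h_def by (cases "x = 0") (auto simp: indicator_def)
  have h_cont: "isCont h x" if "x > 0" for x
  proof -
    have "isCont g x"
      using g_cont that by (simp add: continuous_on_eq_continuous_at)
    moreover have "eventually (\<lambda>y. h y = g y) (nhds x)"
      using eventually_nhds_in_open[of "{0<..}" x] that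
      by (auto elim!: eventually_mono simp: h_def)
    ultimately show ?thesis
      using isCont_cong by blast
  qed
  \<comment> \<open>Every discontinuity of \<open>h\<close> lies in the closed negative half-line,
    which is \<open>P\<close>-null because \<open>P\<close> lives on \<open>{cl..ch}\<close> and
    \<open>cl\<close> is positive.\<close>
  have "AE x in P. isCont h x"
    using AE_limit_support by eventually_elim (use cl_pos h_cont in auto)
  then have discont_null: "emeasure P {x. \<not> isCont h x} = 0"
    by (subst AE_iff_measurable[symmetric]) auto
  \<comment> \<open>The mapping theorem asks for a distribution at every index, but
    \<open>\<mu> 0\<close> is unconstrained. The sequence is shifted by one, and
    \<open>LIMSEQ_imp_Suc\<close> undoes the shift in the limit.\<close>
  have conv': "weak_conv_m (\<lambda>n. \<mu> (Suc n)) P"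
    using conv unfolding weak_conv_m_def weak_conv_def by (auto intro: LIMSEQ_Suc)
  have "(\<lambda>n. integral\<^sup>L (\<mu> (Suc n)) h) \<longlonglongrightarrow> integral\<^sup>L P h"
    by (rule weak_conv_imp_bdd_ae_continuous_conv[OF mu limit_distribution conv' discont_null h_bound h_meas])
      simp
  then have "(\<lambda>n. integral\<^sup>L (\<mu> n) h) \<longlonglongrightarrow> integral\<^sup>L P h"
    by (rule LIMSEQ_imp_Suc)
  also have "integral\<^sup>L P h = (LINT x:{cl..ch}|P. g x)"
    unfolding set_lebesgue_integral_def
  proof (rule integral_cong_AE)
    show "h \<in> borel_measurable P"
      using h_meas by simp
    have "continuous_on {cl..ch} g"
      using g_cont by (rule continuous_on_subset) (use cl_pos in auto)
    then show "(\<lambda>x. indicator {cl..ch} x *\<^sub>R g x) \<in> borel_measurable P"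
      using borel_measurable_continuous_on_indicator[of "{cl..ch}" g] by simp
    show "AE x in P. h x = indicator {cl..ch} x *\<^sub>R g x"
      using AE_limit_support by eventually_elim (use cl_pos in \<open>auto simp: h_def\<close>)
  qed
  finally show ?thesis
    by (simp add: h_def set_lebesgue_integral_def)
qed

end

text \<open>Measurability into \<open>count_space (A n)\<close> confines the samples to the alphabet
  at every point of the sample space, not just almost surely. The assumptions on the random measures
  therefore apply to every realised sample.\<close>

lemma (in sampled_source) sample_in_alphabet:
  assumes "n \<ge> 1" "\<omega> \<in> space M"
  shows "length (sample X n \<omega>) = n" "set (sample X n \<omega>) \<subseteq> A n"
proof -
  have "X n i \<in> measurable M (count_space (A n))" if "i \<in> {1..n}" for i
    using sample_indep[OF assms(1)] that unfolding indep_vars_def by blast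
  then have "X n i \<omega> \<in> A n" if "i \<in> {1..n}" for i
    using measurable_space[of "X n i" M "count_space (A n)" \<omega>] that assms(2) by auto
  then show "length (sample X n \<omega>) = n" "set (sample X n \<omega>) \<subseteq> A n"
    unfolding sample_def by auto
qed

text \<open>The common form of both estimators. For each fixed outcome at which the random measures
  converge weakly, the deterministic limit theorem applies; \<open>g\<close> may replace
  \<open>f\<close> in the limit because they agree on \<open>{cl..ch}\<close>.\<close>

lemma (in sampled_source) consistent_set_integral:
  assumes Q: "\<And>n xs. n \<ge> 1 \<Longrightarrow> length xs = n \<Longrightarrow> set xs \<subseteq> A n \<Longrightarrow> real_distribution (Q n xs)"
    and conv: "AE \<omega> in M. weak_conv_m (\<lambda>n. Q n (sample X n \<omega>)) P"
    and g_cont: "continuous_on {0<..} g"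
    and g_bdd: "bounded (g ` {0<..})"
    and g_eq: "\<And>x. x \<in> {cl..ch} \<Longrightarrow> g x = f x"
  shows "consistent_estimator M X cl ch P f (\<lambda>n xs. LINT x:{0..}|Q n xs. g x)"
proof -
  have lim: "(LINT x:{cl..ch}|P. g x) = (LINT x:{cl..ch}|P. f x)"
    unfolding set_lebesgue_integral_def
    by (rule Bochner_Integration.integral_cong) (auto simp: indicator_def g_eq)
  show ?thesis
    unfolding consistent_estimator_def using conv AE_space
  proof eventually_elim
    case (elim \<omega>)
    have "(\<lambda>n. LINT x:{0..}|Q n (sample X n \<omega>). g x) \<longlonglongrightarrow> (LINT x:{cl..ch}|P. g x)"
      using elim by (intro set_integral_weak_conv g_cont g_bdd Q sample_in_alphabet)
    then show ?case
      by (simp add: lim)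
  qed
qed

theorem lemma2:
  fixes A :: "nat \<Rightarrow> 'a set"
    and p :: "nat \<Rightarrow> 'a pmf"
    and cl ch :: real
    and P :: "real measure"
    and M :: "'w measure"
    and X :: "nat \<Rightarrow> nat \<Rightarrow> 'w \<Rightarrow> 'a"
    and Y :: "'w measure \<Rightarrow> (nat \<Rightarrow> 'a set) \<Rightarrow> (nat \<Rightarrow> 'a pmf) \<Rightarrow>
              (nat \<Rightarrow> nat \<Rightarrow> 'w \<Rightarrow> 'a) \<Rightarrow> nat \<Rightarrow> 'w \<Rightarrow> real"
    and fs :: "nat \<Rightarrow> real \<Rightarrow> real"
    and f :: "real \<Rightarrow> real"
    and Q :: "nat \<Rightarrow> 'a list \<Rightarrow> real measure"
  assumes source: "sampled_source A p cl ch P M X"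
    and problem: "canonical_estimation_problem Y fs f"
    and random_measures:
      "\<And>n xs. n \<ge> 1 \<Longrightarrow> length xs = n \<Longrightarrow> set xs \<subseteq> A n \<Longrightarrow> nonneg_distribution (Q n xs)"
    and weak_convergence: "AE \<omega> in M. weak_conv_m (\<lambda>n. Q n (sample X n \<omega>)) P"
  shows "(\<forall>D>1. {cl..ch} \<subseteq> {inverse D..D} \<longrightarrow>
            consistent_estimator M X cl ch P f (\<lambda>n xs. LINT x:{0..}|Q n xs. tapered f D x)) \<and>
         (bounded (f ` {0<..}) \<longrightarrow>
            (\<forall>f0. consistent_estimator M X cl ch P f (\<lambda>n xs. LINT x:{0..}|Q n xs. (f(0 := f0)) x)))"
proof -
  interpret sampled_source A p cl ch P M X by (rule source)
  have f_cont: "continuous_on {0<..} f"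
    using problem unfolding canonical_estimation_problem_def by blast
  have Q: "real_distribution (Q n xs)" if "n \<ge> 1" "length xs = n" "set xs \<subseteq> A n" for n xs
    using random_measures[OF that] unfolding nonneg_distribution_def by blast
  have "consistent_estimator M X cl ch P f (\<lambda>n xs. LINT x:{0..}|Q n xs. tapered f D x)"
    if "D > 1" "{cl..ch} \<subseteq> {inverse D..D}" for D
    by (rule consistent_set_integral[OF Q weak_convergence])
      (use that f_cont in \<open>auto intro!: continuous_on_tapered bounded_tapered tapered_eq\<close>)
  moreover have "consistent_estimator M X cl ch P f (\<lambda>n xs. LINT x:{0..}|Q n xs. (f(0 := f0)) x)"
    if "bounded (f ` {0<..})" for f0
  proof (rule consistent_set_integral[OF Q weak_convergence])
    \<comment> \<open>The update at 0 leaves the function unchanged on the open half-line, so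
      continuity and boundedness there carry over from \<open>f\<close>.\<close>
    show "continuous_on {0<..} (f(0 := f0))"
      using f_cont by (rule continuous_on_eq) auto
    have "(f(0 := f0)) ` {0<..} = f ` {0<..}"
      by (rule image_cong) auto
    then show "bounded ((f(0 := f0)) ` {0<..})"
      using that by simp
    show "(f(0 := f0)) x = f x" if "x \<in> {cl..ch}" for x
      using that cl_pos by auto
  qed
  ultimately show ?thesis
    by blast
qed

end
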